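(* Let $G$ be a regular finite simple graph with $n\ge 2$ vertices and eigenvalues $\lambda_1\ge\lambda_2\ge\cdots\ge\lambda_n$ (listed with multiplicity). Let $k\ge 1$ be an integer and let $r=\alpha_k(G)$ be the size of a maximum $k$-independent set of $G$. Let $p\in\mathbb{R}_k[x]$, and put $\Lambda(p)=\max_{2\le i\le n}p(\lambda_i)$ and $\lambda(p)=\min_{2\le i\le n}p(\lambda_i)$. Assume that $p(\lambda_1)\ge\Lambda(p)>0$, that $\lambda(p)<0$, and that $\Lambda(p)\ge|\lambda(p)|(r-1)$. Then $$r=\alpha_k(G)\le 1+\frac{\Lambda(p)}{p(\lambda_1)}(n-1).$$
   Context: $\mathbb{R}_k[x]$ denotes the set of real polynomials of degree at most $k$. A $k$-independent set of $G$ is a set of vertices such that any two distinct vertices of the set are at distance greater than $k$ in $G$ (vertices in different components are at infinite distance); the $k$-independence number $\alpha_k(G)$ is the maximum size of such a set. The eigenvalues of a graph are those of its adjacency matrix. *)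

theory Defs
  imports "Graph_Theory.Graph_Theory" "Jordan_Normal_Form.Char_Poly"
begin

text \<open>
  A finite simple graph is a \<^locale>\<open>pair_graph\<close>: a finite vertex set together with a symmetric,
  irreflexive set of ordered pairs, each edge being present in both directions.  Out-degrees are
  therefore the usual degrees.
\<close>

definition regular_graph :: "'a pair_pre_digraph \<Rightarrow> bool" where
  "regular_graph G \<longleftrightarrow> (\<exists>d. \<forall>v \<in> pverts G. out_degree (with_proj G) v = d)"

text \<open>
  With unit weights, the shortest-path cost of the library is the infimum of the lengths of the
  walks from \<open>u\<close> to \<open>v\<close>; it is \<open>\<infinity>\<close> if there is no such walk.
\<close>

definition graph_dist :: "'a pair_pre_digraph \<Rightarrow> 'a \<Rightarrow> 'a \<Rightarrow> ereal" where
  "graph_dist G u v = wf_digraph.\<mu> (with_proj G) (\<lambda>_. 1) u v"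

definition k_independent :: "'a pair_pre_digraph \<Rightarrow> nat \<Rightarrow> 'a set \<Rightarrow> bool" where
  "k_independent G k S \<longleftrightarrow> S \<subseteq> pverts G \<and>
     (\<forall>u \<in> S. \<forall>v \<in> S. u \<noteq> v \<longrightarrow> graph_dist G u v > ereal (real k))"

definition k_independence_number :: "'a pair_pre_digraph \<Rightarrow> nat \<Rightarrow> nat" where
  "k_independence_number G k = Max {card S | S. k_independent G k S}"

text \<open>
  The list \<open>vs\<close> is meant to enumerate the vertices without repetition.  It only fixes the order of
  the rows and columns: the characteristic polynomial does not depend on it.
\<close>

definition adjacency_matrix :: "'a pair_pre_digraph \<Rightarrow> 'a list \<Rightarrow> real mat" where
  "adjacency_matrix G vs =
     mat (length vs) (length vs) (\<lambda>(i, j). if (vs ! i, vs ! j) \<in> parcs G then 1 else 0)"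

text \<open>
  \<open>ev 1, \<dots>, ev n\<close> are the eigenvalues of the \<open>n \<times> n\<close> matrix \<open>A\<close>, each repeated according to
  its multiplicity as a root of the characteristic polynomial, in decreasing order.  Values of
  \<open>ev\<close> at other indices are irrelevant.
\<close>

definition ordered_eigenvalues :: "real mat \<Rightarrow> (nat \<Rightarrow> real) \<Rightarrow> bool" where
  "ordered_eigenvalues A ev \<longleftrightarrow>
     char_poly A = (\<Prod>i = 1..dim_row A. [:- ev i, 1:]) \<and>
     (\<forall>i \<in> {1..dim_row A}. \<forall>j \<in> {1..dim_row A}. i \<le> j \<longrightarrow> ev j \<le> ev i)"

end

theory Submission
  imports Defs "Jordan_Normal_Form.Schur_Decomposition"
begin

text \<open>
  Let \<open>P = p(\<lambda>\<^sub>1)\<close>, where \<open>\<lambda>\<^sub>1\<close> is the degree and belongs to the all-ones vector.  On the orthogonal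
  complement of that vector the quadratic form of \<open>p(A)\<close> lies between \<open>\<lambda>(p)\<close> and \<open>\<Lambda>(p)\<close>.  If \<open>S\<close> is
  a \<open>k\<close>-independent set of size \<open>r \<ge> 2\<close>, then the submatrix of \<open>p(A)\<close> on \<open>S\<close> is diagonal, because nonzero
  entries of \<open>A\<^sup>i\<close> come from walks of length \<open>i\<close>.  The differences of two unit vectors of \<open>S\<close> show that
  any two of these diagonal entries have sum at most \<open>2 \<Lambda>(p)\<close>, so all of them have sum \<open>T \<le> r \<Lambda>(p)\<close>.
  The projection of the indicator vector of \<open>S\<close> gives \<open>T - P r\<^sup>2/n \<ge> \<lambda>(p) (r - r\<^sup>2/n)\<close>.  Together,
  \<open>P r \<le> n \<Lambda>(p) + (n - r) \<bar>\<lambda>(p)\<bar>\<close>, and \<open>\<bar>\<lambda>(p)\<bar> \<le> \<Lambda>(p)/(r - 1)\<close> turns this into the claim.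
\<close>

section \<open>Orthogonal diagonalization of real symmetric matrices\<close>

text \<open>Complete the eigenvector to a basis and apply Gram-Schmidt, which leaves the first
  vector alone; normalising only rescales it, so column 0 is still an eigenvector for
  \<open>e\<close>.\<close>

lemma orthogonal_matrix_extending_eigenvector:
  fixes A :: "real mat"
  assumes A: "A \<in> carrier_mat n n" and e: "eigenvalue A e"
  obtains W where "W \<in> carrier_mat n n" "W\<^sup>T * W = 1\<^sub>m n" "A *\<^sub>v col W 0 = e \<cdot>\<^sub>v col W 0"
proof -
  from e obtain v where "eigenvector A v e" unfolding eigenvalue_def by blast
  with A have v: "v \<in> carrier_vec n" and v0: "v \<noteq> 0\<^sub>v n" and Av: "A *\<^sub>v v = e \<cdot>\<^sub>v v"
    unfolding eigenvector_def by auto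
  interpret cof_vec_space n "TYPE(real)" .
  define b where "b = basis_completion v"
  define ws where "ws = gram_schmidt n b"
  note bc = basis_completion[OF v v0, folded b_def]
  have n: "n \<noteq> 0" using v v0 by (metis eq_vecI index_zero_vec(2) carrier_vecD not_less0)
  have ws: "set ws \<subseteq> carrier_vec n" "corthogonal ws" "length ws = n"
    using gram_schmidt_result[OF bc(2,4,5) refl, folded ws_def] bc(6) by auto
  obtain vs where bv: "b = v # vs" using bc(6,7) n by (cases b) auto
  have "hd ws = v" unfolding ws_def bv by (rule gram_schmidt_hd[OF v])
  then have ws0: "ws ! 0 = v" using ws(3) n by (metis hd_conv_nth length_0_conv)
  have wsc: "ws ! i \<in> carrier_vec n" if "i < n" for i using ws that by auto
  define N where "N i = sqrt (ws ! i \<bullet> ws ! i)" for i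
  define us where "us = map (\<lambda>i. (1 / N i) \<cdot>\<^sub>v (ws ! i)) [0..<n]"
  define W where "W = mat_of_cols n us"
  have W: "W \<in> carrier_mat n n" unfolding W_def us_def by (auto simp: mat_of_cols_def)
  have colW: "col W i = (1 / N i) \<cdot>\<^sub>v (ws ! i)" if "i < n" for i
    using that wsc[OF that] unfolding W_def us_def by (subst col_mat_of_cols) auto
  \<comment> \<open>The equivalence also says that no \<open>ws ! i\<close> has norm zero, so
    division by \<open>N i\<close> is legitimate.\<close>
  have ortho: "ws ! i \<bullet> ws ! j = 0 \<longleftrightarrow> i \<noteq> j" if "i < n" "j < n" for i j
    using corthogonalD[OF ws(2)] that ws(3) by simp
  have N: "N i * N i = ws ! i \<bullet> ws ! i" "N i \<noteq> 0" if "i < n" for i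
  proof -
    have "ws ! i \<bullet> ws ! i \<ge> 0" unfolding scalar_prod_def by (intro sum_nonneg) simp
    then show "N i * N i = ws ! i \<bullet> ws ! i" unfolding N_def by simp
    show "N i \<noteq> 0" using ortho[OF that that] unfolding N_def by simp
  qed
  have "W\<^sup>T * W = 1\<^sub>m n"
  proof (rule eq_matI)
    fix i j assume ij: "i < dim_row (1\<^sub>m n :: real mat)" "j < dim_col (1\<^sub>m n :: real mat)"
    then have i: "i < n" and j: "j < n" by auto
    have "(W\<^sup>T * W) $$ (i, j) = col W i \<bullet> col W j" using W i j by simp
    also have "\<dots> = (ws ! i \<bullet> ws ! j) / (N i * N j)"
      using wsc[OF i] wsc[OF j] by (simp add: colW i j)
    also have "\<dots> = 1\<^sub>m n $$ (i, j)"
      using ortho[OF i j] N[OF i] i j by auto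
    finally show "(W\<^sup>T * W) $$ (i, j) = 1\<^sub>m n $$ (i, j)" .
  qed (use W in auto)
  moreover have "A *\<^sub>v col W 0 = e \<cdot>\<^sub>v col W 0"
    using n v A Av by (simp add: colW ws0 mult_mat_vec smult_smult_assoc mult.commute)
  ultimately show ?thesis using W that by blast
qed

text \<open>Deflation: an orthogonal change of basis splits off one eigenvector, and the induction
  hypothesis treats the remaining symmetric block. The given factorisation supplies a real
  eigenvalue at each stage and fixes the order on the diagonal.\<close>

lemma real_spectral_theorem:
  fixes A :: "real mat"
  assumes "A \<in> carrier_mat n n" and "A\<^sup>T = A"
    and "char_poly A = (\<Prod>i<n. [:- \<mu> i, 1:])"
  shows "\<exists>W \<in> carrier_mat n n. W\<^sup>T * W = 1\<^sub>m n \<and> W\<^sup>T * A * W = mat_diag n \<mu>"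
  using assms
proof (induction n arbitrary: A \<mu>)
  case 0
  then show ?case by (intro bexI[of _ "1\<^sub>m 0"]) (auto intro!: eq_matI simp: mat_diag_def)
next
  case (Suc m)
  note A = Suc.prems(1) and sym = Suc.prems(2)
  have cp: "char_poly A = [:- \<mu> 0, 1:] * (\<Prod>i<m. [:- \<mu> (Suc i), 1:])"
    unfolding Suc.prems(3) by (rule prod.lessThan_Suc_shift)
  have "eigenvalue A (\<mu> 0)" unfolding eigenvalue_root_char_poly[OF A] cp by simp
  then obtain V where V: "V \<in> carrier_mat (Suc m) (Suc m)" and VV: "V\<^sup>T * V = 1\<^sub>m (Suc m)"
    and ev: "A *\<^sub>v col V 0 = \<mu> 0 \<cdot>\<^sub>v col V 0"
    using orthogonal_matrix_extending_eigenvector[OF A] by blast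
  have VV': "V * V\<^sup>T = 1\<^sub>m (Suc m)" using mat_mult_left_right_inverse[OF _ V VV] V by simp
  define B where "B = V\<^sup>T * A * V"
  have B: "B \<in> carrier_mat (Suc m) (Suc m)" using A V unfolding B_def by auto
  have Bt: "B\<^sup>T = B" using A V sym unfolding B_def
    by (simp add: transpose_mult[of _ "Suc m" "Suc m" _ "Suc m"])
  \<comment> \<open>Column 0 of \<open>V\<close> is an eigenvector orthogonal to the other columns,
    so column 0 of \<open>B\<close> vanishes below the corner; symmetry gives the same for row
    0.\<close>
  have col0: "B $$ (i, 0) = (if i = 0 then \<mu> 0 else 0)" if "i < Suc m" for i
  proof -
    have "B $$ (i, 0) = col V i \<bullet> (A *\<^sub>v col V 0)"
      using A V that unfolding B_def
      by (simp add: mult_mat_vec_def assoc_mult_mat[of _ _ "Suc m" _ "Suc m" _ "Suc m"])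
    also have "\<dots> = \<mu> 0 * (col V i \<bullet> col V 0)" unfolding ev using V by simp
    also have "col V i \<bullet> col V 0 = (V\<^sup>T * V) $$ (i, 0)" using V that by simp
    finally show ?thesis using that by (simp add: VV)
  qed
  have row0: "B $$ (0, i) = (if i = 0 then \<mu> 0 else 0)" if "i < Suc m" for i
    using col0[OF that] Bt B that by (metis carrier_matD index_transpose_mat(1) zero_less_Suc)
  define C where "C = mat m m (\<lambda>(i, j). B $$ (Suc i, Suc j))"
  have C: "C \<in> carrier_mat m m" unfolding C_def by simp
  define E where "E = mat 1 1 (\<lambda>_. \<mu> 0)"
  have E: "E \<in> carrier_mat 1 1" unfolding E_def by simp
  have Bblock: "B = four_block_mat E (0\<^sub>m 1 m) (0\<^sub>m m 1) C"
  proof (rule eq_matI)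
    fix i j assume "i < dim_row (four_block_mat E (0\<^sub>m 1 m) (0\<^sub>m m 1) C)"
      "j < dim_col (four_block_mat E (0\<^sub>m 1 m) (0\<^sub>m m 1) C)"
    then show "B $$ (i, j) = four_block_mat E (0\<^sub>m 1 m) (0\<^sub>m m 1) C $$ (i, j)"
      using row0[of j] col0[of i] E C unfolding E_def C_def
      by (cases i; cases j) auto
  qed (use B E C in auto)
  have Ct: "C\<^sup>T = C" 
  proof (rule eq_matI)
    fix i j assume "i < dim_row C" "j < dim_col C"
    then have ij: "i < m" "j < m" using C by auto
    have "B $$ (Suc j, Suc i) = B\<^sup>T $$ (Suc i, Suc j)" using ij B by auto
    then show "C\<^sup>T $$ (i, j) = C $$ (i, j)" using ij Bt unfolding C_def by auto
  qed (use C in auto)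
  have "char_poly B = char_poly A"
    by (rule char_poly_similar, unfold similar_mat_def, intro exI, rule similar_mat_witI[where P = "V\<^sup>T" and Q = V])
      (use A B V VV VV' in \<open>auto simp: B_def\<close>)
  moreover have "char_poly B = char_poly E * char_poly C"
    unfolding Bblock by (rule char_poly_four_block_zeros_col[OF E _ C]) simp
  moreover have "char_poly E = [:- \<mu> 0, 1:]"
    by (simp add: E_def char_poly_defs det_def sign_def)
  ultimately have "[:- \<mu> 0, 1:] * char_poly C = [:- \<mu> 0, 1:] * (\<Prod>i<m. [:- \<mu> (Suc i), 1:])"
    using cp by simp
  then have "char_poly C = (\<Prod>i<m. [:- \<mu> (Suc i), 1:])"
    by (metis mult_cancel_left pCons_eq_0_iff zero_neq_one)
  from Suc.IH[OF C Ct this] obtain U where U: "U \<in> carrier_mat m m" and UU: "U\<^sup>T * U = 1\<^sub>m m"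
    and UCU: "U\<^sup>T * C * U = mat_diag m (\<lambda>i. \<mu> (Suc i))" by blast
  \<comment> \<open>Padding \<open>U\<close> by a corner entry 1 leaves the split-off eigenvector
    fixed, so \<open>V * F\<close> diagonalizes \<open>A\<close>.\<close>
  define F where "F = four_block_mat (1\<^sub>m 1) (0\<^sub>m 1 m) (0\<^sub>m m 1) U"
  have F: "F \<in> carrier_mat (Suc m) (Suc m)" using U unfolding F_def by auto
  have Ft: "F\<^sup>T = four_block_mat (1\<^sub>m 1) (0\<^sub>m 1 m) (0\<^sub>m m 1) U\<^sup>T"
    unfolding F_def using U by (subst transpose_four_block_mat) auto
  have FF: "F\<^sup>T * F = 1\<^sub>m (Suc m)"
    unfolding Ft unfolding F_def using U UU
    by (subst mult_four_block_mat[of _ 1 1 _ m _ m _ _ 1 _ m]) auto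
  have "F\<^sup>T * B = four_block_mat E (0\<^sub>m 1 m) (0\<^sub>m m 1) (U\<^sup>T * C)"
    unfolding Ft Bblock using U C E
    by (subst mult_four_block_mat[of _ 1 1 _ m _ m _ _ 1 _ m]) auto
  then have "F\<^sup>T * B * F = four_block_mat E (0\<^sub>m 1 m) (0\<^sub>m m 1) (U\<^sup>T * C * U)"
    unfolding F_def using U C E
    by (simp, subst mult_four_block_mat[of _ 1 1 _ m _ m _ _ 1 _ m]) auto
  also have "\<dots> = mat_diag (Suc m) \<mu>"
    unfolding UCU E_def mat_diag_def by (rule eq_matI) auto
  finally have FBF: "F\<^sup>T * B * F = mat_diag (Suc m) \<mu>" .
  have tr: "(V * F)\<^sup>T = F\<^sup>T * V\<^sup>T" using V F by (rule transpose_mult)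
  have "(V * F)\<^sup>T * (V * F) = F\<^sup>T * (V\<^sup>T * V) * F"
    using V F unfolding tr by (simp add: assoc_mult_mat[of _ "Suc m" "Suc m" _ "Suc m" _ "Suc m"])
  also have "\<dots> = 1\<^sub>m (Suc m)" using FF F by (simp add: VV)
  finally have 1: "(V * F)\<^sup>T * (V * F) = 1\<^sub>m (Suc m)" .
  have "(V * F)\<^sup>T * A * (V * F) = F\<^sup>T * B * F"
    using V F A unfolding tr B_def
    by (simp add: assoc_mult_mat[of _ "Suc m" "Suc m" _ "Suc m" _ "Suc m"])
  then show ?case using 1 FBF V F by (intro bexI[of _ "V * F"]) auto
qed

section \<open>Quadratic forms of matrix polynomials in an eigenbasis\<close>

text \<open>\<open>W u j\<close> is coordinate \<open>u\<close> of the eigenvector number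
  \<open>j\<close>. Stating everything by entries reduces later arguments to interchanging finite
  sums.\<close>

locale orthonormal_eigenbasis =
  fixes n :: nat and A :: "real mat" and \<mu> :: "nat \<Rightarrow> real" and W :: "nat \<Rightarrow> nat \<Rightarrow> real"
  assumes carrier: "A \<in> carrier_mat n n"
    and sym: "u < n \<Longrightarrow> v < n \<Longrightarrow> A $$ (u, v) = A $$ (v, u)"
    and rows_orthonormal: "u < n \<Longrightarrow> v < n \<Longrightarrow> (\<Sum>j<n. W u j * W v j) = of_bool (u = v)"
    and cols_orthonormal: "i < n \<Longrightarrow> j < n \<Longrightarrow> (\<Sum>u<n. W u i * W u j) = of_bool (i = j)"
    and eigen: "u < n \<Longrightarrow> j < n \<Longrightarrow> (\<Sum>v<n. A $$ (u, v) * W v j) = \<mu> j * W u j"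

lemma orthonormal_eigenbasis_exists:
  assumes A: "A \<in> carrier_mat n n" and sym: "A\<^sup>T = A"
    and cp: "char_poly A = (\<Prod>i<n. [:- \<mu> i, 1:])"
  obtains W where "orthonormal_eigenbasis n A \<mu> W"
proof -
  obtain V where V: "V \<in> carrier_mat n n" and VV: "V\<^sup>T * V = 1\<^sub>m n"
    and D: "V\<^sup>T * A * V = mat_diag n \<mu>"
    using real_spectral_theorem[OF assms] by blast
  have VV': "V * V\<^sup>T = 1\<^sub>m n" using mat_mult_left_right_inverse[OF _ V VV] V by simp
  \<comment> \<open>Inserting \<open>V * V\<^sup>T\<close> turns the diagonalization into the
    eigenvector equations for the columns of \<open>V\<close>.\<close>
  have "A * V = V * V\<^sup>T * (A * V)" using A V by (simp add: VV')
  also have "\<dots> = V * mat_diag n \<mu>"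
    using A V by (simp flip: D add: assoc_mult_mat[of _ n n _ n _ n])
  finally have AV: "A * V = V * mat_diag n \<mu>" .
  have "orthonormal_eigenbasis n A \<mu> (\<lambda>u j. V $$ (u, j))"
  proof
    fix u v assume uv: "u < n" "v < n"
    show "A $$ (u, v) = A $$ (v, u)"
      using uv A sym by (metis carrier_matD index_transpose_mat(1))
    have "(\<Sum>j<n. V $$ (u, j) * V $$ (v, j)) = (V * V\<^sup>T) $$ (u, v)"
      using uv V by (simp add: scalar_prod_def lessThan_atLeast0)
    also have "\<dots> = of_bool (u = v)" using uv by (simp add: VV')
    finally show "(\<Sum>j<n. V $$ (u, j) * V $$ (v, j)) = of_bool (u = v)" .
    have "(\<Sum>j<n. V $$ (j, u) * V $$ (j, v)) = (V\<^sup>T * V) $$ (u, v)"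
      using uv V by (simp add: scalar_prod_def lessThan_atLeast0)
    also have "\<dots> = of_bool (u = v)" using uv by (simp add: VV)
    finally show "(\<Sum>j<n. V $$ (j, u) * V $$ (j, v)) = of_bool (u = v)" .
    have "(A * V) $$ (u, v) = (\<Sum>w<n. A $$ (u, w) * V $$ (w, v))"
      using uv A V by (simp add: scalar_prod_def lessThan_atLeast0)
    moreover have "(V * mat_diag n \<mu>) $$ (u, v) = \<mu> v * V $$ (u, v)"
      using uv V by (simp add: mat_diag_mult_right[of _ n n])
    ultimately show "(\<Sum>w<n. A $$ (u, w) * V $$ (w, v)) = \<mu> v * V $$ (u, v)"
      by (simp add: AV)
  qed (rule A)
  then show ?thesis by (rule that)
qed

context orthonormal_eigenbasis
begin

definition coord :: "(nat \<Rightarrow> real) \<Rightarrow> nat \<Rightarrow> real" where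
  "coord x j = (\<Sum>u<n. x u * W u j)"

text \<open>\<open>poly_entry p u v\<close> is the entry of \<open>p(A)\<close> at \<open>(u, v)\<close>; see \<open>poly_entry_eq\<close> below.\<close>

definition poly_entry :: "real poly \<Rightarrow> nat \<Rightarrow> nat \<Rightarrow> real" where
  "poly_entry p u v = (\<Sum>j<n. poly p (\<mu> j) * (W u j * W v j))"

text \<open>The weights \<open>f = 1\<close> give Parseval's identity, and
  \<open>f j = poly p (\<mu> j)\<close> gives the bilinear form of \<open>p(A)\<close>.\<close>

lemma sum_coord_mult:
  "(\<Sum>j<n. f j * (coord x j * coord y j)) =
     (\<Sum>u<n. \<Sum>v<n. x u * y v * (\<Sum>j<n. f j * (W u j * W v j)))"
proof -
  have "(\<Sum>j<n. f j * (coord x j * coord y j)) =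
      (\<Sum>j<n. \<Sum>u<n. \<Sum>v<n. x u * y v * (f j * (W u j * W v j)))"
    unfolding coord_def sum_product by (simp add: sum_distrib_left mult_ac)
  also have "\<dots> = (\<Sum>u<n. \<Sum>j<n. \<Sum>v<n. x u * y v * (f j * (W u j * W v j)))"
    by (rule sum.swap)
  also have "\<dots> = (\<Sum>u<n. \<Sum>v<n. \<Sum>j<n. x u * y v * (f j * (W u j * W v j)))"
    by (intro sum.cong refl sum.swap)
  finally show ?thesis by (simp add: sum_distrib_left)
qed

lemma parseval: "(\<Sum>j<n. coord x j * coord y j) = (\<Sum>u<n. x u * y u)"
proof -
  have "(\<Sum>j<n. coord x j * coord y j) = (\<Sum>u<n. \<Sum>v<n. x u * y v * of_bool (u = v))"
    using sum_coord_mult[of "\<lambda>_. 1" x y] by (simp add: rows_orthonormal)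
  also have "\<dots> = (\<Sum>u<n. x u * y u)"
    by (intro sum.cong refl) (simp add: of_bool_def if_distrib sum.delta cong: if_cong)
  finally show ?thesis .
qed

lemma poly_form:
  "(\<Sum>j<n. poly p (\<mu> j) * (coord x j * coord y j)) =
     (\<Sum>u<n. \<Sum>v<n. x u * y v * poly_entry p u v)"
  unfolding poly_entry_def by (rule sum_coord_mult)

lemma pow_entry:
  assumes "u < n" "v < n"
  shows "(A ^\<^sub>m m) $$ (u, v) = (\<Sum>j<n. \<mu> j ^ m * (W u j * W v j))"
  using assms
proof (induction m arbitrary: u v)
  case 0
  then show ?case using carrier by (simp add: rows_orthonormal)
next
  case (Suc m)
  have "(A ^\<^sub>m Suc m) $$ (u, v) = (\<Sum>w<n. (A ^\<^sub>m m) $$ (u, w) * A $$ (w, v))"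
    using carrier pow_carrier_mat[OF carrier, of m] Suc.prems
    by (simp add: scalar_prod_def lessThan_atLeast0)
  \<comment> \<open>Symmetry moves \<open>v\<close> to the row index, where the eigenvector equation
    can absorb the sum over \<open>w\<close>.\<close>
  also have "\<dots> = (\<Sum>w<n. \<Sum>j<n. \<mu> j ^ m * W u j * (A $$ (v, w) * W w j))"
    using Suc.prems by (intro sum.cong refl) (simp add: Suc.IH sum_distrib_left sum_distrib_right sym[of v] mult_ac)
  also have "\<dots> = (\<Sum>j<n. \<Sum>w<n. \<mu> j ^ m * W u j * (A $$ (v, w) * W w j))"
    by (rule sum.swap)
  also have "\<dots> = (\<Sum>j<n. \<mu> j ^ Suc m * (W u j * W v j))"
    using Suc.prems by (simp add: eigen flip: sum_distrib_left) (simp add: mult_ac)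
  finally show ?case .
qed

lemma poly_entry_eq:
  assumes "u < n" "v < n"
  shows "poly_entry p u v = (\<Sum>i\<le>degree p. coeff p i * (A ^\<^sub>m i) $$ (u, v))"
  unfolding poly_entry_def poly_altdef pow_entry[OF assms] sum_distrib_right sum_distrib_left
  by (subst sum.swap) (simp add: mult_ac)

end

section \<open>Constant row sums: the all-ones vector and the largest eigenvalue\<close>

locale regular_eigenbasis = orthonormal_eigenbasis +
  fixes d :: real
  assumes row_sum: "u < n \<Longrightarrow> (\<Sum>v<n. A $$ (u, v)) = d"
    and nonneg: "u < n \<Longrightarrow> v < n \<Longrightarrow> A $$ (u, v) \<ge> 0"
    and decreasing: "i \<le> j \<Longrightarrow> j < n \<Longrightarrow> \<mu> j \<le> \<mu> i"
    and n_pos: "n > 0"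
begin

text \<open>Symmetry lets \<open>A\<close> act on the all-ones vector instead of on eigenvector
  \<open>j\<close>. Hence an eigenvector not orthogonal to the all-ones vector has eigenvalue
  \<open>d\<close>.\<close>

lemma coord_one_eigen:
  assumes "j < n"
  shows "\<mu> j * coord (\<lambda>_. 1) j = d * coord (\<lambda>_. 1) j"
proof -
  have "\<mu> j * coord (\<lambda>_. 1) j = (\<Sum>u<n. \<Sum>v<n. A $$ (u, v) * W v j)"
    unfolding coord_def using assms by (simp add: eigen sum_distrib_left)
  also have "\<dots> = (\<Sum>v<n. \<Sum>u<n. A $$ (v, u) * W v j)"
    by (subst sum.swap) (intro sum.cong refl, simp add: sym)
  also have "\<dots> = d * coord (\<lambda>_. 1) j"
    unfolding coord_def by (simp add: row_sum sum_distrib_left flip: sum_distrib_right)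
  finally show ?thesis .
qed

text \<open>The eigenbasis expansion of the all-ones vector, read off by Parseval against a unit
  vector.\<close>

lemma sum_coord_one:
  assumes "u < n"
  shows "(\<Sum>j<n. coord (\<lambda>_. 1) j * W u j) = 1"
proof -
  have "coord (\<lambda>w. of_bool (w = u)) j = W u j" for j
  proof -
    have "{..<n} \<inter> {w. w = u} = {u}" using assms by auto
    then show ?thesis unfolding coord_def by (simp add: sum_of_bool_mult_eq)
  qed
  then have "(\<Sum>j<n. coord (\<lambda>_. 1) j * W u j) = (\<Sum>w<n. 1 * of_bool (w = u))"
    using parseval[of "\<lambda>_. 1" "\<lambda>w. of_bool (w = u)"] by simp
  also have "\<dots> = 1" using assms by (simp add: of_bool_def)
  finally show ?thesis .
qed

text \<open>The Rayleigh quotient of a unit eigenvector is bounded termwise by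
  \<open>a * b <= (a^2 + b^2) / 2\<close>. Nonnegative entries preserve this inequality, and both
  rows and columns sum to \<open>d\<close>.\<close>

lemma eigenvalue_le:
  assumes "j < n"
  shows "\<mu> j \<le> d"
proof -
  have "\<mu> j = (\<Sum>u<n. W u j * (\<Sum>v<n. A $$ (u, v) * W v j))"
    using assms cols_orthonormal[of j j] by (simp add: eigen mult.left_commute flip: sum_distrib_left)
  also have "\<dots> = (\<Sum>u<n. \<Sum>v<n. A $$ (u, v) * (W u j * W v j))"
    by (simp add: sum_distrib_left mult_ac)
  also have "\<dots> \<le> (\<Sum>u<n. \<Sum>v<n. A $$ (u, v) * ((W u j)\<^sup>2 / 2 + (W v j)\<^sup>2 / 2))"
  proof (intro sum_mono mult_left_mono nonneg)
    fix u v
    show "W u j * W v j \<le> (W u j)\<^sup>2 / 2 + (W v j)\<^sup>2 / 2"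
      using sum_squares_bound[of "W u j" "W v j"] by simp
  qed auto
  also have "\<dots> = (\<Sum>u<n. \<Sum>v<n. A $$ (u, v) * ((W u j)\<^sup>2 / 2)) +
      (\<Sum>u<n. \<Sum>v<n. A $$ (u, v) * ((W v j)\<^sup>2 / 2))"
    by (simp add: distrib_left sum.distrib)
  also have "(\<Sum>u<n. \<Sum>v<n. A $$ (u, v) * ((W v j)\<^sup>2 / 2)) =
      (\<Sum>u<n. \<Sum>v<n. A $$ (u, v) * ((W u j)\<^sup>2 / 2))"
    by (subst sum.swap) (intro sum.cong refl, simp add: sym)
  also have "(\<Sum>u<n. \<Sum>v<n. A $$ (u, v) * ((W u j)\<^sup>2 / 2)) = (\<Sum>u<n. d * ((W u j)\<^sup>2 / 2))"
    by (intro sum.cong refl) (simp only: row_sum lessThan_iff flip: sum_distrib_right)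
  also have "\<dots> = d / 2 * (\<Sum>u<n. W u j * W u j)"
    by (simp add: sum_distrib_left power2_eq_square)
  also have "\<dots> + \<dots> = d" using assms by (simp add: cols_orthonormal)
  finally show ?thesis .
qed

text \<open>The all-ones vector is nonzero, so some eigenvector is not orthogonal to it and has
  eigenvalue \<open>d\<close>; no eigenvalue exceeds \<open>d\<close>.\<close>

lemma largest_eigenvalue: "\<mu> 0 = d"
proof -
  have "\<exists>j<n. coord (\<lambda>_. 1) j \<noteq> 0"
    using sum_coord_one[OF n_pos] by (force intro: ccontr)
  then obtain j where j: "j < n" "coord (\<lambda>_. 1) j \<noteq> 0" by blast
  then have "\<mu> j = d" using coord_one_eigen by auto
  with decreasing[of 0 j] j eigenvalue_le[OF n_pos] show ?thesis by auto
qed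

text \<open>This is \<open>p(A) 1 = p(d) 1\<close> paired with \<open>x\<close>: only indices with
  \<open>\<mu> j = d\<close> contribute.\<close>

lemma poly_form_one:
  "(\<Sum>j<n. poly p (\<mu> j) * (coord x j * coord (\<lambda>_. 1) j)) = poly p (\<mu> 0) * (\<Sum>u<n. x u)"
proof -
  have "poly p (\<mu> j) * (coord x j * coord (\<lambda>_. 1) j) =
      poly p (\<mu> 0) * (coord x j * coord (\<lambda>_. 1) j)" if "j < n" for j
    using coord_one_eigen[OF that] by (auto simp: largest_eigenvalue)
  then have "(\<Sum>j<n. poly p (\<mu> j) * (coord x j * coord (\<lambda>_. 1) j)) =
      poly p (\<mu> 0) * (\<Sum>j<n. coord x j * coord (\<lambda>_. 1) j)"
    unfolding sum_distrib_left by (intro sum.cong) auto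
  then show ?thesis by (simp add: parseval)
qed

text \<open>If \<open>\<mu> 0\<close> is a multiple eigenvalue, the basis vector \<open>W _ 0\<close> need not be constant, but then
  \<open>\<mu> 0\<close> occurs among the other eigenvalues.\<close>

lemma coord_0_eq_0_or_repeated:
  assumes "(\<Sum>u<n. x u) = 0"
  shows "coord x 0 = 0 \<or> (\<exists>j. 1 \<le> j \<and> j < n \<and> \<mu> j = \<mu> 0)"
proof (rule disjCI)
  assume "\<not> (\<exists>j. 1 \<le> j \<and> j < n \<and> \<mu> j = \<mu> 0)"
  then have z: "coord (\<lambda>_. 1) j = 0" if "1 \<le> j" "j < n" for j
    using coord_one_eigen[OF that(2)] that largest_eigenvalue by auto
  \<comment> \<open>Now \<mu> 0 is simple, so the all-ones vector is \<open>c\<close> times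
    eigenvector 0, and orthogonality to one means orthogonality to the other.\<close>
  define c where "c = coord (\<lambda>_. 1) 0"
  have "c * W u 0 = 1" if "u < n" for u
  proof -
    have "(\<Sum>j<n. coord (\<lambda>_. 1) j * W u j) = (\<Sum>j\<in>{0}. coord (\<lambda>_. 1) j * W u j)"
      using n_pos z by (intro sum.mono_neutral_right) auto
    then show ?thesis using sum_coord_one[OF that] by (simp add: c_def)
  qed
  then have "c * coord x 0 = (\<Sum>u<n. x u)"
    unfolding coord_def sum_distrib_left by (intro sum.cong refl) (simp add: mult.left_commute)
  moreover have "c \<noteq> 0" using \<open>\<And>u. u < n \<Longrightarrow> c * W u 0 = 1\<close> n_pos by force
  ultimately show "coord x 0 = 0" using assms by simp
qed

text \<open>In eigencoordinates the form is a weighted sum of squares. Index 0 either has coordinate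
  zero or shares its weight with some index \<open>j >= 1\<close>, so bounds for
  \<open>j >= 1\<close> suffice.\<close>

lemma poly_form_bounds:
  assumes x: "(\<Sum>u<n. x u) = 0"
    and b: "\<And>j. 1 \<le> j \<Longrightarrow> j < n \<Longrightarrow> l \<le> poly p (\<mu> j) \<and> poly p (\<mu> j) \<le> L"
  shows "(\<Sum>j<n. poly p (\<mu> j) * (coord x j * coord x j)) \<le> L * (\<Sum>u<n. x u * x u)"
    and "l * (\<Sum>u<n. x u * x u) \<le> (\<Sum>j<n. poly p (\<mu> j) * (coord x j * coord x j))"
proof -
  have *: "coord x j = 0 \<or> l \<le> poly p (\<mu> j) \<and> poly p (\<mu> j) \<le> L" if "j < n" for j
  proof (cases "j = 0")
    case True
    then show ?thesis using b coord_0_eq_0_or_repeated[OF x] by metis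
  next
    case False
    then show ?thesis using b[of j] that by simp
  qed
  have "(\<Sum>j<n. poly p (\<mu> j) * (coord x j * coord x j)) \<le> (\<Sum>j<n. L * (coord x j * coord x j))"
    using * by (intro sum_mono) (force intro: mult_right_mono)
  then show "(\<Sum>j<n. poly p (\<mu> j) * (coord x j * coord x j)) \<le> L * (\<Sum>u<n. x u * x u)"
    by (simp add: parseval flip: sum_distrib_left)
  have "(\<Sum>j<n. l * (coord x j * coord x j)) \<le> (\<Sum>j<n. poly p (\<mu> j) * (coord x j * coord x j))"
    using * by (intro sum_mono) (force intro: mult_right_mono)
  then show "l * (\<Sum>u<n. x u * x u) \<le> (\<Sum>j<n. poly p (\<mu> j) * (coord x j * coord x j))"
    by (simp add: parseval flip: sum_distrib_left)
qed

section \<open>Trace and ratio bounds for index sets on which \<open>p(A)\<close> is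
  diagonal\<close>

lemma coord_diff: "coord (\<lambda>w. x w - c * y w) j = coord x j - c * coord y j"
  unfolding coord_def by (simp add: left_diff_distrib sum_subtractf sum_distrib_left mult.assoc)

lemma sum_of_bool_mem:
  assumes "S \<subseteq> {..<n}"
  shows "(\<Sum>u<n. of_bool (u \<in> S) * f u) = (sum f S :: real)"
    and "(\<Sum>u<n. of_bool (u \<in> S)) = real (card S)"
proof -
  have S: "{..<n} \<inter> {u. u \<in> S} = S" using assms by auto
  show 1: "(\<Sum>u<n. of_bool (u \<in> S) * f u) = sum f S" for f :: "nat \<Rightarrow> real"
    by (subst sum_of_bool_mult_eq) (simp_all only: S finite_lessThan)
  show "(\<Sum>u<n. of_bool (u \<in> S)) = real (card S)" using 1[of "\<lambda>_. 1"]
    by (simp only: mult_1_right) simp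
qed

text \<open>Tests the quadratic form of \<open>p(A)\<close> on the difference of two unit vectors.\<close>

lemma diagonal_pair_bound:
  assumes uv: "u < n" "v < n" "u \<noteq> v" and zero: "poly_entry p u v = 0"
    and b: "\<And>j. 1 \<le> j \<Longrightarrow> j < n \<Longrightarrow> l \<le> poly p (\<mu> j) \<and> poly p (\<mu> j) \<le> L"
  shows "poly_entry p u u + poly_entry p v v \<le> 2 * L"
proof -
  \<comment> \<open>The factor 1 and the singletons bring the test vector into the shape of
    \<open>coord_diff\<close> and \<open>sum_of_bool_mem\<close>.\<close>
  define x :: "nat \<Rightarrow> real" where "x w = of_bool (w \<in> {u}) - 1 * of_bool (w \<in> {v})" for w
  have sub: "{u} \<subseteq> {..<n}" "{v} \<subseteq> {..<n}" using uv by auto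
  have x: "coord x j = W u j - W v j" for j
    unfolding x_def coord_diff unfolding coord_def by (simp only: sum_of_bool_mem sub) simp
  have "(\<Sum>w<n. x w) = 0"
    unfolding x_def by (simp only: sum_subtractf mult_1 sum_of_bool_mem sub) simp
  note bound = poly_form_bounds(1)[OF this b]
  have "(\<Sum>w<n. x w * x w) = (\<Sum>w<n. of_bool (w \<in> {u}) * 1) + (\<Sum>w<n. of_bool (w \<in> {v}) * 1)"
    unfolding sum.distrib[symmetric] x_def using uv(3) by (intro sum.cong) auto
  then have 1: "(\<Sum>w<n. x w * x w) = 2" by (simp only: sum_of_bool_mem sub) simp
  have "(\<Sum>j<n. poly p (\<mu> j) * (coord x j * coord x j)) =
      poly_entry p u u - 2 * poly_entry p u v + poly_entry p v v"
    unfolding poly_entry_def x sum_distrib_left sum_subtractf[symmetric] sum.distrib[symmetric]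
    by (intro sum.cong refl) (simp add: algebra_simps)
  then show ?thesis using bound 1 zero by simp
qed

text \<open>Summing \<open>diagonal_pair_bound\<close> over ordered pairs of distinct elements
  counts each diagonal entry \<open>2 * (r - 1)\<close> times; \<open>r >= 2\<close> allows
  cancelling \<open>r - 1\<close>.\<close>

lemma trace_bound:
  assumes S: "S \<subseteq> {..<n}" "card S \<ge> 2"
    and zero: "\<And>u v. u \<in> S \<Longrightarrow> v \<in> S \<Longrightarrow> u \<noteq> v \<Longrightarrow> poly_entry p u v = 0"
    and b: "\<And>j. 1 \<le> j \<Longrightarrow> j < n \<Longrightarrow> l \<le> poly p (\<mu> j) \<and> poly p (\<mu> j) \<le> L"
  shows "(\<Sum>u\<in>S. poly_entry p u u) \<le> real (card S) * L"
proof -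
  have fin: "finite S" using S(1) finite_subset by blast
  define r where "r = real (card S)"
  define T where "T = (\<Sum>u\<in>S. poly_entry p u u)"
  have r: "r \<ge> 2" using S(2) unfolding r_def by simp
  have "2 * r * T = (\<Sum>u\<in>S. \<Sum>v\<in>S. poly_entry p u u + poly_entry p v v)"
    unfolding r_def T_def by (simp add: sum.distrib sum_distrib_left mult.assoc)
  \<comment> \<open>The pair bound needs distinct indices; the correction term makes the summand an
    equality when \<open>u = v\<close>.\<close>
  also have "\<dots> \<le> (\<Sum>u\<in>S. \<Sum>v\<in>S. 2 * L + of_bool (v = u) * (2 * poly_entry p v v - 2 * L))"
  proof (intro sum_mono)
    fix u v assume uv: "u \<in> S" "v \<in> S"
    show "poly_entry p u u + poly_entry p v v
        \<le> 2 * L + of_bool (v = u) * (2 * poly_entry p v v - 2 * L)"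
      using diagonal_pair_bound[OF _ _ _ zero b, of u v] uv S(1) by (cases "u = v") auto
  qed
  also have "\<dots> = (\<Sum>u\<in>S. r * (2 * L) + (2 * poly_entry p u u - 2 * L))"
  proof (intro sum.cong refl)
    fix u assume "u \<in> S"
    then have "S \<inter> {v. v = u} = {u}" by auto
    then show "(\<Sum>v\<in>S. 2 * L + of_bool (v = u) * (2 * poly_entry p v v - 2 * L)) =
        r * (2 * L) + (2 * poly_entry p u u - 2 * L)"
      using fin by (simp add: sum.distrib r_def sum_of_bool_mult_eq)
  qed
  also have "\<dots> = r * (r * (2 * L)) + 2 * T - r * (2 * L)"
    by (simp add: sum.distrib sum_subtractf r_def T_def flip: sum_distrib_left)
  finally have "(r - 1) * T \<le> (r - 1) * (r * L)" by (simp add: algebra_simps)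
  then show ?thesis using r unfolding T_def r_def by simp
qed

text \<open>Tests the quadratic form of \<open>p(A)\<close> on the projection of the indicator vector of \<open>S\<close> to the
  complement of the all-ones vector, as in Hoffman's ratio bound.\<close>

lemma ratio_bound:
  assumes S: "S \<subseteq> {..<n}"
    and zero: "\<And>u v. u \<in> S \<Longrightarrow> v \<in> S \<Longrightarrow> u \<noteq> v \<Longrightarrow> poly_entry p u v = 0"
    and b: "\<And>j. 1 \<le> j \<Longrightarrow> j < n \<Longrightarrow> l \<le> poly p (\<mu> j) \<and> poly p (\<mu> j) \<le> L"
  defines "r \<equiv> real (card S)"
  shows "poly p (\<mu> 0) * r\<^sup>2 / n + l * (r - r\<^sup>2 / n) \<le> (\<Sum>u\<in>S. poly_entry p u u)"
proof -
  have fin: "finite S" using S(1) finite_subset by blast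
  define y where "y w = (of_bool (w \<in> S) :: real)" for w
  \<comment> \<open>The trailing 1 stands for the all-ones vector, so \<open>coord_diff\<close>
    applies with \<open>c = r / n\<close>.\<close>
  define x where "x w = y w - (r / n) * 1" for w
  have y: "(\<Sum>w<n. y w) = r" "(\<Sum>w<n. y w * y w) = r"
    unfolding y_def r_def by (simp_all only: sum_of_bool_mem[OF S]) simp
  have "(\<Sum>w<n. x w) = 0" unfolding x_def using n_pos y by (simp add: sum_subtractf)
  note bound = poly_form_bounds(2)[OF this b]
  have "(\<Sum>w<n. x w * x w) = (\<Sum>w<n. y w * y w - 2 * (r / n) * y w + (r / n)\<^sup>2)"
    unfolding x_def by (intro sum.cong refl) (simp add: power2_eq_square algebra_simps)
  also have "\<dots> = r - 2 * (r / n) * r + n * (r / n)\<^sup>2"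
    by (simp only: sum.distrib sum_subtractf y flip: sum_distrib_left) simp
  also have "\<dots> = r - r\<^sup>2 / n" using n_pos by (simp add: power2_eq_square field_simps)
  finally have xx: "(\<Sum>w<n. x w * x w) = r - r\<^sup>2 / n" .
  \<comment> \<open>Expanding the square leaves two terms involving the all-ones vector;
    \<open>poly_form_one\<close> evaluates both, and together they contribute
    \<open>- poly p (\<mu> 0) * r^2 / n\<close>.\<close>
  have "(\<Sum>j<n. poly p (\<mu> j) * (coord x j * coord x j)) =
      (\<Sum>j<n. poly p (\<mu> j) * (coord y j * coord y j))
      - 2 * (r / n) * (\<Sum>j<n. poly p (\<mu> j) * (coord y j * coord (\<lambda>_. 1) j))
      + (r / n)\<^sup>2 * (\<Sum>j<n. poly p (\<mu> j) * (coord (\<lambda>_. 1) j * coord (\<lambda>_. 1) j))"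
    unfolding x_def coord_diff sum_distrib_left sum_subtractf[symmetric] sum.distrib[symmetric]
    by (intro sum.cong refl) (simp add: power2_eq_square algebra_simps)
  also have "\<dots> = (\<Sum>j<n. poly p (\<mu> j) * (coord y j * coord y j))
      - 2 * (r / n) * (poly p (\<mu> 0) * r) + (r / n)\<^sup>2 * (poly p (\<mu> 0) * n)"
    by (simp add: poly_form_one y)
  also have "\<dots> = (\<Sum>j<n. poly p (\<mu> j) * (coord y j * coord y j)) - poly p (\<mu> 0) * r\<^sup>2 / n"
    using n_pos by (simp add: power2_eq_square field_simps)
  also have "(\<Sum>j<n. poly p (\<mu> j) * (coord y j * coord y j)) =
      (\<Sum>u<n. y u * (\<Sum>v<n. y v * poly_entry p u v))"
    unfolding poly_form by (simp add: sum_distrib_left mult.assoc)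
  also have "\<dots> = (\<Sum>u\<in>S. \<Sum>v\<in>S. poly_entry p u v)"
    unfolding y_def by (simp only: sum_of_bool_mem(1)[OF S])
  also have "\<dots> = (\<Sum>u\<in>S. \<Sum>v\<in>{u}. poly_entry p u v)"
    using fin zero by (intro sum.cong refl sum.mono_neutral_right) auto
  finally show ?thesis using bound xx by simp
qed

text \<open>The trace is eliminated between \<open>ratio_bound\<close> and
  \<open>trace_bound\<close>. Sets with at most one element offer no pair to test, but there the
  right-hand side is already at least 1.\<close>

lemma independent_set_bound:
  assumes S: "S \<subseteq> {..<n}"
    and zero: "\<And>u v. u \<in> S \<Longrightarrow> v \<in> S \<Longrightarrow> u \<noteq> v \<Longrightarrow> poly_entry p u v = 0"
    and b: "\<And>j. 1 \<le> j \<Longrightarrow> j < n \<Longrightarrow> l \<le> poly p (\<mu> j) \<and> poly p (\<mu> j) \<le> L"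
    and L: "L \<ge> 0" "L \<ge> - l * (real (card S) - 1)" and P: "poly p (\<mu> 0) > 0"
  shows "real (card S) \<le> 1 + L / poly p (\<mu> 0) * (real n - 1)"
proof (cases "card S \<ge> 2")
  case False
  then have "real (card S) \<le> 1" by simp
  moreover have "0 \<le> L / poly p (\<mu> 0) * (real n - 1)" using L P n_pos by simp
  ultimately show ?thesis by linarith
next
  case True
  define r where "r = real (card S)"
  define P where "P = poly p (\<mu> 0)"
  have r: "r \<ge> 2" "r \<le> n"
    using True card_mono[OF _ S] unfolding r_def by auto
  have "P * r\<^sup>2 / n + l * (r - r\<^sup>2 / n) \<le> r * L"
    using order_trans[OF ratio_bound[OF S zero b] trace_bound[OF S True zero b]]
    unfolding P_def r_def .
  then have "r * (P * r) \<le> r * (L * n - l * (n - r))"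
    using n_pos by (simp add: field_simps power2_eq_square)
  then have "P * r \<le> L * n - l * (n - r)" using r by simp
  \<comment> \<open>The factor \<open>r - 1\<close> brings in the hypothesis on
    \<open>- l * (r - 1)\<close>. The resulting bound \<open>(r - 1) * L * n + L * (n - r)\<close>
    equals \<open>r * L * (n - 1)\<close>, so \<open>r\<close> cancels.\<close>
  then have "(r - 1) * (P * r) \<le> (r - 1) * (L * n - l * (n - r))"
    using r by (intro mult_left_mono) auto
  also have "\<dots> = (r - 1) * L * n + (- l * (r - 1)) * (n - r)" by (simp add: algebra_simps)
  also have "\<dots> \<le> (r - 1) * L * n + L * (n - r)"
    using L(2) r unfolding r_def by (intro add_left_mono mult_right_mono) auto
  finally have "r * (P * (r - 1)) \<le> r * (L * (real n - 1))" by (simp add: algebra_simps)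
  then have "P * (r - 1) \<le> L * (real n - 1)" using r by simp
  then show ?thesis using P unfolding P_def[symmetric] r_def[symmetric]
    by (simp add: field_simps)
qed

end

section \<open>Powers of the adjacency matrix and walks\<close>

text \<open>A nonzero entry of a matrix product has a nonzero summand, which supplies a shorter walk
  and one final arc.\<close>

lemma (in pair_graph) awalk_of_pow_adjacency_matrix:
  assumes "set vs = pverts G" "i < length vs" "j < length vs"
    and "(adjacency_matrix G vs ^\<^sub>m m) $$ (i, j) \<noteq> 0"
  shows "\<exists>q. awalk (vs ! i) q (vs ! j) \<and> length q = m"
  using assms(3,4)
proof (induction m arbitrary: j)
  case 0
  then have "i = j" using assms(2) by (auto simp: adjacency_matrix_def split: if_splits)
  moreover have "vs ! i \<in> pverts G" using assms(1,2) nth_mem by metis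
  ultimately show ?case by (intro exI[of _ "[]"]) (simp add: awalk_Nil_iff)
next
  case (Suc m)
  let ?A = "adjacency_matrix G vs"
  have A: "?A \<in> carrier_mat (length vs) (length vs)" unfolding adjacency_matrix_def by simp
  have "(?A ^\<^sub>m Suc m) $$ (i, j) = (\<Sum>w<length vs. (?A ^\<^sub>m m) $$ (i, w) * ?A $$ (w, j))"
    using A pow_carrier_mat[OF A, of m] assms(2) Suc.prems(1)
    by (simp add: scalar_prod_def lessThan_atLeast0)
  with Suc.prems(2) obtain w where w: "w < length vs" "(?A ^\<^sub>m m) $$ (i, w) \<noteq> 0" "?A $$ (w, j) \<noteq> 0"
    by (metis (no_types, lifting) lessThan_iff mult_zero_left mult_zero_right
        sum.not_neutral_contains_not_neutral)
  from Suc.IH[OF w(1,2)] obtain q where q: "awalk (vs ! i) q (vs ! w)" "length q = m" by blast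
  have "(vs ! w, vs ! j) \<in> parcs G"
    using w(1,3) Suc.prems(1) unfolding adjacency_matrix_def by (auto split: if_splits)
  then have "awalk (vs ! w) [(vs ! w, vs ! j)] (vs ! j)"
    by (auto simp: awalk_Cons_iff awalk_Nil_iff dest: in_arcsD2)
  with q show ?case by (intro exI[of _ "q @ [(vs ! w, vs ! j)]"]) (auto intro: awalk_appendI)
qed

lemma (in pair_graph) graph_dist_le_length:
  assumes "awalk u q v"
  shows "graph_dist G u v \<le> ereal (real (length q))"
proof -
  have "awalk_cost (\<lambda>_. 1) q = real (length q)" by (induction q) auto
  then show ?thesis using min_cost_le_walk_cost[OF assms, of "\<lambda>_. 1"] unfolding graph_dist_def by simp
qed

lemma adjacency_matrix_row_sum:
  assumes "pair_graph G" "distinct vs" "set vs = pverts G" "i < length vs"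
  shows "(\<Sum>j<length vs. adjacency_matrix G vs $$ (i, j)) = out_degree (with_proj G) (vs ! i)"
proof -
  interpret pair_graph G by fact
  have "(\<Sum>j<length vs. adjacency_matrix G vs $$ (i, j)) =
      (\<Sum>j<length vs. of_bool ((vs ! i, vs ! j) \<in> parcs G))"
    using assms(4) unfolding adjacency_matrix_def by (intro sum.cong) auto
  also have "\<dots> = (\<Sum>v\<in>pverts G. of_bool ((vs ! i, v) \<in> parcs G))"
    by (rule sum.reindex_bij_betw) (use assms bij_betw_nth in blast)
  also have "\<dots> = card {v \<in> pverts G. (vs ! i, v) \<in> parcs G}"
    using pair_finite_verts by (simp add: Int_def)
  also have "card {v \<in> pverts G. (vs ! i, v) \<in> parcs G} = card (out_arcs (with_proj G) (vs ! i))"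
    by (rule bij_betw_same_card[of "\<lambda>v. (vs ! i, v)"])
      (auto simp: bij_betw_def inj_on_def out_arcs_def dest: in_arcsD2)
  finally show ?thesis unfolding out_degree_def .
qed

text \<open>The maximum is over a finite nonempty set: sizes are bounded by the number of vertices,
  and the empty set qualifies.\<close>

lemma k_independence_number_attained:
  assumes "pair_graph G"
  obtains S where "k_independent G k S" "card S = k_independence_number G k"
proof -
  interpret pair_graph G by fact
  have "{card S | S. k_independent G k S} \<subseteq> {..card (pverts G)}"
    using pair_finite_verts by (auto simp: k_independent_def intro: card_mono)
  then have "finite {card S | S. k_independent G k S}" using finite_subset by blast
  moreover have "k_independent G k {}" unfolding k_independent_def by simp
  ultimately have "k_independence_number G k \<in> {card S | S. k_independent G k S}"
    unfolding k_independence_number_def by (intro Max_in) auto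
  then show ?thesis using that by auto
qed

section \<open>Transfer of the spectral bound to graphs\<close>

theorem theorem3p7:
  fixes G :: "'a pair_pre_digraph" and vs :: "'a list" and ev :: "nat \<Rightarrow> real"
    and n k r :: nat and p :: "real poly" and Lmax Lmin :: real
  assumes "pair_graph G" and "regular_graph G"
    and "n = card (pverts G)" and "n \<ge> 2"
    and "distinct vs" and "set vs = pverts G"
    and "ordered_eigenvalues (adjacency_matrix G vs) ev"
    and "k \<ge> 1" and "r = k_independence_number G k"
    and "degree p \<le> k"
    and "Lmax = Max ((\<lambda>i. poly p (ev i)) ` {2..n})"
    and "Lmin = Min ((\<lambda>i. poly p (ev i)) ` {2..n})"
    and "poly p (ev 1) \<ge> Lmax" and "Lmax > 0" and "Lmin < 0"
    and "Lmax \<ge> \<bar>Lmin\<bar> * (real r - 1)"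
  shows "real r \<le> 1 + Lmax / poly p (ev 1) * (real n - 1)"
proof -
  interpret G: pair_graph G by fact
  let ?A = "adjacency_matrix G vs"
  \<comment> \<open>The shift to indices from 0 makes \<open>\<mu> 0\<close> the largest eigenvalue
    and turns the range \<open>{2..n}\<close> into \<open>1 <= j < n\<close>.\<close>
  define \<mu> where "\<mu> j = ev (Suc j)" for j
  have len: "length vs = n" using assms(3,5,6) by (metis distinct_card)
  have A: "?A \<in> carrier_mat n n" unfolding adjacency_matrix_def len by simp
  have "?A\<^sup>T = ?A"
    unfolding adjacency_matrix_def by (rule eq_matI) (auto dest: G.arcs_symmetric)
  moreover have "char_poly ?A = (\<Prod>j<n. [:- \<mu> j, 1:])"
    using assms(7) A unfolding ordered_eigenvalues_def \<mu>_def
    by (simp add: prod.atLeast1_atMost_eq)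
  ultimately obtain W where W: "orthonormal_eigenbasis n ?A \<mu> W"
    using orthonormal_eigenbasis_exists[OF A] by blast
  obtain d where d: "\<And>v. v \<in> pverts G \<Longrightarrow> out_degree (with_proj G) v = d"
    using assms(2) unfolding regular_graph_def by blast
  interpret regular_eigenbasis n ?A \<mu> W "real d"
  proof (rule regular_eigenbasis.intro[OF W], unfold_locales)
    show "(\<Sum>v<n. ?A $$ (u, v)) = real d" if "u < n" for u
      using adjacency_matrix_row_sum[OF assms(1,5,6), of u] d[of "vs ! u"] that assms(6) len
      by (metis nth_mem)
    show "\<mu> j \<le> \<mu> i" if "i \<le> j" "j < n" for i j
      using assms(7) A that unfolding ordered_eigenvalues_def \<mu>_def by simp
    show "0 \<le> ?A $$ (u, v)" if "u < n" "v < n" for u v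
      using that len unfolding adjacency_matrix_def by simp
  qed (use assms(4) in simp)
  obtain S where S: "k_independent G k S" "card S = r"
    by (rule k_independence_number_attained[OF assms(1), of k]) (simp add: assms(9))
  \<comment> \<open>The matrix bound concerns row indices, so \<open>S\<close> is pulled back along
    the enumeration \<open>vs\<close>.\<close>
  define I where "I = {i. i < n \<and> vs ! i \<in> S}"
  have "bij_betw ((!) vs) I S"
    unfolding bij_betw_def
  proof
    show "inj_on ((!) vs) I" using assms(5) len by (auto simp: I_def inj_on_def nth_eq_iff_index_eq)
    have "S \<subseteq> (!) vs ` {..<n}"
      using S(1) assms(6) len by (auto simp: k_independent_def nth_image lessThan_atLeast0)
    then show "(!) vs ` I = S" unfolding I_def by auto
  qed
  then have I: "card I = r" using S(2) bij_betw_same_card by metis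
  have zero: "poly_entry p u v = 0" if uv: "u \<in> I" "v \<in> I" "u \<noteq> v" for u v
  proof -
    have uv': "u < n" "v < n" using uv unfolding I_def by auto
    then have "vs ! u \<noteq> vs ! v" using uv(3) assms(5) len by (simp add: nth_eq_iff_index_eq)
    then have far: "graph_dist G (vs ! u) (vs ! v) > ereal (real k)"
      using S(1) uv unfolding k_independent_def I_def by blast
    \<comment> \<open>A nonzero entry would give a walk of length \<open>m <= k\<close> between
      vertices at distance greater than \<open>k\<close>.\<close>
    have "(?A ^\<^sub>m m) $$ (u, v) = 0" if "m \<le> degree p" for m
    proof (rule ccontr)
      assume "(?A ^\<^sub>m m) $$ (u, v) \<noteq> 0"
      then obtain q where "G.awalk (vs ! u) q (vs ! v)" "length q = m"
        using G.awalk_of_pow_adjacency_matrix[OF assms(6)] uv' len by blast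
      then have "graph_dist G (vs ! u) (vs ! v) \<le> ereal (real m)"
        using G.graph_dist_le_length by blast
      also have "\<dots> \<le> ereal (real k)" using that assms(10) by simp
      finally show False using far by simp
    qed
    then show ?thesis using poly_entry_eq[OF uv'] by simp
  qed
  have bounds: "Lmin \<le> poly p (\<mu> j) \<and> poly p (\<mu> j) \<le> Lmax" if "1 \<le> j" "j < n" for j
    using that unfolding assms(11,12) \<mu>_def by (auto intro!: Max_ge Min_le)
  have sub: "I \<subseteq> {..<n}" unfolding I_def by auto
  \<comment> \<open>Here \<open>poly p (\<mu> 0) >= Lmax > 0\<close> gives positivity, and
    \<open>Lmin < 0\<close> rewrites its absolute value as \<open>- Lmin\<close>.\<close>
  have "real (card I) \<le> 1 + Lmax / poly p (\<mu> 0) * (real n - 1)"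
    using assms(13-16) by (intro independent_set_bound[OF sub zero bounds])
      (simp_all add: I \<mu>_def)
  then show ?thesis unfolding I \<mu>_def by simp
qed

end
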